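(* Let $G$ be a group generated by its elements of order $2$. Then there exists a semigroup $S$ with a proper involution such that $\mathscr C(S)\cong \mathbb Z_2\times G$. If $G$ is finite, then $S$ may be taken to be finitely generated.
   Context: For a semigroup $S$, an involution of $S$ is a function $\alpha:S\to S$ with $\alpha(xy)=\alpha(y)\alpha(x)$ and $\alpha(\alpha(x))=x$ for all $x,y\in S$, and $\alpha\neq \mathrm{id}_S$. An involution is proper if it is not also a homomorphism $S\to S$. The set of all involutions of $S$ is denoted $I(S)$, and $\mathscr C(S)=\langle I(S)\rangle$ is the subgroup of the symmetric group $\operatorname{Sym}(S)$ on the set $S$ generated by $I(S)$ (trivial if $I(S)=\emptyset$). $\mathbb Z_2$ is the cyclic group of order $2$. *)

theory Defs
  imports "HOL-Algebra.Algebra"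
begin

text \<open>A semigroup is given by an explicit carrier set and a multiplication; the values of the
  multiplication outside the carrier are irrelevant.\<close>

definition semigroup_on :: "'s set \<Rightarrow> ('s \<Rightarrow> 's \<Rightarrow> 's) \<Rightarrow> bool" where
  "semigroup_on S mul \<longleftrightarrow>
     (\<forall>x\<in>S. \<forall>y\<in>S. mul x y \<in> S) \<and>
     (\<forall>x\<in>S. \<forall>y\<in>S. \<forall>z\<in>S. mul (mul x y) z = mul x (mul y z))"

text \<open>Functions from \<open>S\<close> to \<open>S\<close> are extensional, as in \<^const>\<open>BijGroup\<close>, so that the
  identity of \<open>S\<close> is \<open>\<lambda>x\<in>S. x\<close> and distinct HOL functions are distinct maps on \<open>S\<close>.\<close>

definition involutions :: "'s set \<Rightarrow> ('s \<Rightarrow> 's \<Rightarrow> 's) \<Rightarrow> ('s \<Rightarrow> 's) set" where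
  "involutions S mul =
     {\<alpha> \<in> S \<rightarrow>\<^sub>E S.
        (\<forall>x\<in>S. \<forall>y\<in>S. \<alpha> (mul x y) = mul (\<alpha> y) (\<alpha> x)) \<and>
        (\<forall>x\<in>S. \<alpha> (\<alpha> x) = x) \<and>
        \<alpha> \<noteq> (\<lambda>x\<in>S. x)}"

definition proper_involution :: "'s set \<Rightarrow> ('s \<Rightarrow> 's \<Rightarrow> 's) \<Rightarrow> ('s \<Rightarrow> 's) \<Rightarrow> bool" where
  "proper_involution S mul \<alpha> \<longleftrightarrow>
     \<alpha> \<in> involutions S mul \<and>
     \<not> (\<forall>x\<in>S. \<forall>y\<in>S. \<alpha> (mul x y) = mul (\<alpha> x) (\<alpha> y))"

lemma involutions_subset_Bij: "involutions S mul \<subseteq> carrier (BijGroup S)"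
proof
  fix \<alpha> assume a: "\<alpha> \<in> involutions S mul"
  then have "\<alpha> \<in> S \<rightarrow> S" "\<alpha> \<in> extensional S" "\<And>x. x \<in> S \<Longrightarrow> \<alpha> (\<alpha> x) = x"
    by (auto simp: involutions_def PiE_def)
  then have "\<alpha> \<in> extensional S" "bij_betw \<alpha> S S"
    by (auto intro: bij_betw_byWitness[where f' = \<alpha>])
  then show "\<alpha> \<in> carrier (BijGroup S)"
    by (simp add: BijGroup_def Bij_def)
qed

text \<open>\<^const>\<open>BijGroup\<close> is the symmetric group on the set \<open>S\<close>, semigroup structure ignored.\<close>

definition involution_group :: "'s set \<Rightarrow> ('s \<Rightarrow> 's \<Rightarrow> 's) \<Rightarrow> ('s \<Rightarrow> 's) monoid" where
  "involution_group S mul = subgroup_generated (BijGroup S) (involutions S mul)"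

inductive_set subsemigroup_generated :: "('s \<Rightarrow> 's \<Rightarrow> 's) \<Rightarrow> 's set \<Rightarrow> 's set"
  for mul :: "'s \<Rightarrow> 's \<Rightarrow> 's" and A :: "'s set" where
  incl: "a \<in> A \<Longrightarrow> a \<in> subsemigroup_generated mul A"
| mult: "x \<in> subsemigroup_generated mul A \<Longrightarrow> y \<in> subsemigroup_generated mul A \<Longrightarrow>
    mul x y \<in> subsemigroup_generated mul A"

definition finitely_generated_semigroup :: "'s set \<Rightarrow> ('s \<Rightarrow> 's \<Rightarrow> 's) \<Rightarrow> bool" where
  "finitely_generated_semigroup S mul \<longleftrightarrow>
     (\<exists>A. finite A \<and> A \<subseteq> S \<and> subsemigroup_generated mul A = S)"

text \<open>HOL cannot quantify existentially over types, so existence statements about semigroups need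
  a fixed ambient type.  This one consists of sets of words over the alphabet of pairs of a natural
  number and a finite word over \<open>'a\<close>; it accommodates every semigroup presented by generators from
  that alphabet, in particular a copy of every semigroup of cardinality at most that of \<open>'a\<close>
  or countable.\<close>

type_synonym 'a word_class = "(nat \<times> 'a list) list set"

end

theory Submission
  imports Defs
begin

text \<open>The semigroup is the Rees quotient of a free semigroup by the words outside a language \<open>L\<close>
  closed under factors and reversal.  An anti-automorphism permutes the letters, which are the
  irreducible elements, and is then reversal composed with a letter permutation preserving \<open>L\<close>.
  The letters are a point and a colour for every element of \<open>G\<close>, and the words of length 3 in \<open>L\<close>
  encode the coloured Cayley graph of \<open>G\<close> together with a linear order on the colours.  An
  involutive permutation preserving a linear order is the identity, so the letter permutations
  that arise are the translations by elements \<open>g\<close> with \<open>g\<^sup>2 = 1\<close>.  Hence the involutions are the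
  elements \<open>(1, g)\<close> of \<open>\<int>\<^sub>2 \<times> G\<close> with \<open>g\<^sup>2 = 1\<close>, reversal being \<open>(1, 1)\<close>, and these generate
  \<open>\<int>\<^sub>2 \<times> G\<close>.\<close>

section \<open>Quotients of free semigroups by reversible factorial languages\<close>

locale reversible_factorial_language =
  fixes L :: "'l list set"
  assumes Nil_notin: "[] \<notin> L"
    and factor_left: "u @ v \<in> L \<Longrightarrow> u \<noteq> [] \<Longrightarrow> u \<in> L"
    and factor_right: "u @ v \<in> L \<Longrightarrow> v \<noteq> [] \<Longrightarrow> v \<in> L"
    and rev_closed: "w \<in> L \<Longrightarrow> rev w \<in> L"
begin

text \<open>The empty set is the zero of the quotient.\<close>

definition quot :: "'l list set set" where
  "quot = insert {} ((\<lambda>w. {w}) ` L)"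

text \<open>Intersecting with \<open>L\<close> collapses forbidden words to zero, and the
  set-builder form makes \<open>{}\<close> absorbing without a case distinction.\<close>

definition conc :: "'l list set \<Rightarrow> 'l list set \<Rightarrow> 'l list set" where
  "conc A B = {u @ v | u v. u \<in> A \<and> v \<in> B} \<inter> L"

lemma quot_cases:
  assumes "A \<in> quot"
  obtains "A = {}" | w where "w \<in> L" "A = {w}"
  using assms by (auto simp: quot_def)

lemma empty_in_quot [simp]: "{} \<in> quot"
  and singleton_in_quot [simp]: "{w} \<in> quot \<longleftrightarrow> w \<in> L"
  by (auto simp: quot_def)

lemma conc_empty [simp]: "conc {} B = {}" "conc A {} = {}"
  by (auto simp: conc_def)

lemma conc_singleton: "conc {u} {v} = (if u @ v \<in> L then {u @ v} else {})"
  by (auto simp: conc_def)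

lemma conc_in_quot: "A \<in> quot \<Longrightarrow> B \<in> quot \<Longrightarrow> conc A B \<in> quot"
  by (auto simp: conc_singleton elim!: quot_cases)

lemma semigroup_quot: "semigroup_on quot conc"
proof -
  have "conc (conc A B) C = conc A (conc B C)"
    if A: "A \<in> quot" and B: "B \<in> quot" and C: "C \<in> quot" for A B C
  proof -
    consider "A = {} \<or> B = {} \<or> C = {}"
      | u v w where "A = {u}" "B = {v}" "C = {w}" "u \<in> L" "v \<in> L" "w \<in> L"
      using A B C by (auto simp: quot_def)
    then show ?thesis
    proof cases
      case 2
      \<comment> \<open>Factor closure: if the full word is in \<open>L\<close>, neither bracketing
        reaches zero early; if it is not, both end in zero.\<close>
      then have "u @ v \<in> L" "v @ w \<in> L" if "u @ v @ w \<in> L"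
        using that Nil_notin factor_left[of "u @ v" w] factor_right[of u "v @ w"] by auto
      with 2 show ?thesis
        by (auto simp: conc_singleton)
    qed auto
  qed
  then show ?thesis
    by (simp add: semigroup_on_def conc_in_quot)
qed

text \<open>The flag selects reversal, so maps that keep the order of letters and maps that reverse
  it are handled together, and the flags compose by exclusive or.\<close>

definition word_map :: "bool \<Rightarrow> ('l \<Rightarrow> 'l) \<Rightarrow> 'l list set \<Rightarrow> 'l list set" where
  "word_map b f = (\<lambda>A\<in>quot. (\<lambda>w. (if b then rev else id) (map f w)) ` A)"

lemma word_map_empty [simp]: "word_map b f {} = {}"
  by (simp add: word_map_def)

lemma word_map_singleton:
  "w \<in> L \<Longrightarrow> word_map b f {w} = {(if b then rev else id) (map f w)}"
  by (simp add: word_map_def)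

lemma word_map_cong:
  assumes "\<And>w x. w \<in> L \<Longrightarrow> x \<in> set w \<Longrightarrow> f x = g x"
  shows "word_map b f = word_map b g"
proof -
  have "map f w = map g w" if "w \<in> L" for w
    using assms that by simp
  then show ?thesis
    unfolding word_map_def by (intro restrict_ext) (auto simp: quot_def)
qed

lemma word_map_in_quot:
  assumes "\<And>w. w \<in> L \<Longrightarrow> map f w \<in> L" "A \<in> quot"
  shows "word_map b f A \<in> quot"
  using assms(2) by (cases rule: quot_cases) (auto simp: word_map_singleton assms(1) rev_closed)

lemma word_map_word_map:
  assumes "\<And>w. w \<in> L \<Longrightarrow> map g w \<in> L" "A \<in> quot"
  shows "word_map b f (word_map c g A) = word_map (b \<noteq> c) (f \<circ> g) A"
  using assms(2)
  by (cases rule: quot_cases) (auto simp: word_map_singleton assms(1) rev_closed rev_map)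

text \<open>An equivalence is assumed because a zero product must also go to zero: a word outside
  \<open>L\<close> must not be mapped into \<open>L\<close>. It ranges only over letters that occur
  in \<open>L\<close>.\<close>

lemma word_map_anti:
  assumes iff: "\<And>w. w \<in> lists (\<Union>(set ` L)) \<Longrightarrow> map f w \<in> L \<longleftrightarrow> w \<in> L"
    and A: "A \<in> quot" and B: "B \<in> quot"
  shows "word_map True f (conc A B) = conc (word_map True f B) (word_map True f A)"
proof -
  consider "A = {} \<or> B = {}" | u v where "A = {u}" "B = {v}" "u \<in> L" "v \<in> L"
    using A B by (auto simp: quot_def)
  then show ?thesis
  proof cases
    case 2
    then have "u @ v \<in> lists (\<Union>(set ` L))"
      by auto
    from iff[OF this] have "map f u @ map f v \<in> L \<longleftrightarrow> u @ v \<in> L"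
      by simp
    moreover have "rev (map f v) @ rev (map f u) \<in> L \<longleftrightarrow> map f u @ map f v \<in> L"
      using rev_closed[of "rev (map f v) @ rev (map f u)"] rev_closed[of "map f u @ map f v"]
      by auto
    ultimately show ?thesis
      using 2 by (auto simp: conc_singleton word_map_singleton)
  qed auto
qed

lemma involution_cases:
  assumes \<alpha>: "\<alpha> \<in> involutions quot conc"
  obtains f where "\<alpha> = word_map True f" "\<And>w. w \<in> L \<Longrightarrow> map f w \<in> L"
    "\<And>x. [x] \<in> L \<Longrightarrow> f (f x) = x"
proof -
  have in_quot: "\<alpha> A \<in> quot" if "A \<in> quot" for A
    using \<alpha> that by (auto simp: involutions_def)
  have anti: "\<alpha> (conc A B) = conc (\<alpha> B) (\<alpha> A)" if "A \<in> quot" "B \<in> quot" for A B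
    using \<alpha> that by (auto simp: involutions_def)
  have inv: "\<alpha> (\<alpha> A) = A" if "A \<in> quot" for A
    using \<alpha> that by (auto simp: involutions_def)
  \<comment> \<open>Multiply the zero by its own image: applying \<alpha> to
    \<open>conc {} (\<alpha> {})\<close> gives a product with the factor
    \<open>\<alpha> (\<alpha> {}) = {}\<close>.\<close>
  have zero: "\<alpha> {} = {}"
    using anti[of "{}" "\<alpha> {}"] inv[of "{}"] in_quot[of "{}"] by simp
  have "\<exists>y. \<alpha> {[x]} = {[y]}" if x: "[x] \<in> L" for x
  proof -
    have "\<alpha> {[x]} \<in> quot"
      using x in_quot by simp
    then show ?thesis
    proof (cases rule: quot_cases)
      case 1
      then show ?thesis
        using inv[of "{[x]}"] x zero by simp
    next
      case (2 w)
      then obtain y v where w: "w = y # v"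
        using Nil_notin by (cases w) auto
      show ?thesis
      proof (cases "v = []")
        case False
        then have L: "[y] \<in> L" "v \<in> L"
          using factor_left[of "[y]" v] factor_right[of "[y]" v] 2(1) w by auto
        \<comment> \<open>A longer image would factor as \<open>y\<close> followed by
          \<open>v\<close>; applying \<alpha> again would split the single letter \<open>x\<close>
          into two nonempty words.\<close>
        have "{[x]} = \<alpha> (conc {[y]} {v})"
          using inv[of "{[x]}"] x 2 w by (simp add: conc_singleton)
        also have "\<dots> = conc (\<alpha> {v}) (\<alpha> {[y]})"
          using L by (simp add: anti)
        finally have "[x] \<in> conc (\<alpha> {v}) (\<alpha> {[y]})"
          by blast
        then obtain s t where "[x] = s @ t" "s \<in> \<alpha> {v}" "t \<in> \<alpha> {[y]}"
          by (auto simp: conc_def)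
        moreover have "[] \<notin> \<alpha> {v}" "[] \<notin> \<alpha> {[y]}"
          using in_quot[of "{v}"] in_quot[of "{[y]}"] L Nil_notin by (auto simp: quot_def)
        ultimately show ?thesis
          by (auto simp: Cons_eq_append_conv)
      qed (use 2 w in simp)
    qed
  qed
  then obtain f where f: "\<And>x. [x] \<in> L \<Longrightarrow> \<alpha> {[x]} = {[f x]}"
    by metis
  have word: "\<alpha> {w} = {rev (map f w)}" if "w \<in> L" for w
    using that
  proof (induction w)
    case Nil
    then show ?case
      using Nil_notin by simp
  next
    case (Cons x w)
    then have x: "[x] \<in> L"
      using factor_left[of "[x]" w] by simp
    show ?case
    proof (cases "w = []")
      case False
      then have w: "w \<in> L"
        using factor_right[of "[x]" w] Cons.prems by simp
      have "\<alpha> {x # w} = \<alpha> (conc {[x]} {w})"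
        using Cons.prems by (simp add: conc_singleton)
      also have "\<dots> = conc {rev (map f w)} {[f x]}"
        using x w by (simp add: anti f Cons.IH)
      finally have eq: "\<alpha> {x # w} = conc {rev (map f w)} {[f x]}" .
      \<comment> \<open>Injectivity keeps the image away from zero, which leaves the concatenated
        word as the only possible value of the product.\<close>
      moreover have "\<alpha> {x # w} \<noteq> {}"
        using inv[of "{x # w}"] Cons.prems zero by auto
      ultimately show ?thesis
        by (auto simp: conc_singleton split: if_splits)
    qed (use x f in simp)
  qed
  have "\<alpha> A = word_map True f A" for A
  proof (cases "A \<in> quot")
    case True
    then show ?thesis
      by (cases rule: quot_cases) (simp_all add: zero word word_map_singleton)
  next
    case False
    then show ?thesis
      using \<alpha> by (auto simp: involutions_def word_map_def)
  qed
  moreover have "map f w \<in> L" if "w \<in> L" for w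
    using in_quot[of "{w}"] word[OF that] that rev_closed[of "rev (map f w)"] by auto
  moreover have "f (f x) = x" if "[x] \<in> L" for x
    using inv[of "{[x]}"] f[OF that] in_quot[of "{[x]}"] f[of "f x"] that by auto
  ultimately show thesis
    using that by blast
qed

end

section \<open>The language of a group\<close>

locale ordered_group = group G for G :: "('a, 'b) monoid_scheme" (structure) +
  fixes r :: "'a rel"
  assumes linear: "linear_order_on (carrier G) r"
begin

text \<open>The tag keeps two copies of the group apart; an element enters as a one-letter word
  because the ambient type fixes the letters as \<open>nat \<times> 'a list\<close>.\<close>

abbreviation colour :: "'a \<Rightarrow> nat \<times> 'a list" where
  "colour c \<equiv> (0, [c])"

abbreviation point :: "'a \<Rightarrow> nat \<times> 'a list" where
  "point a \<equiv> (Suc 0, [a])"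

definition letters :: "(nat \<times> 'a list) set" where
  "letters = colour ` carrier G \<union> point ` carrier G"

text \<open>The first kind records the Cayley edge from \<open>a\<close> to \<open>b\<close> with
  its colour. In the second kind the doubled letter marks the larger colour, so the order can still
  be read off after closing under reversal.\<close>

definition triples :: "(nat \<times> 'a list) list set" where
  "triples = {[point a, point b, colour (inv a \<otimes> b)] | a b. a \<in> carrier G \<and> b \<in> carrier G} \<union>
     {[colour c, colour d, colour d] | c d. (c, d) \<in> r}"

text \<open>Admitting all words of length 1 and 2 makes factor closure automatic, since proper
  nonempty factors of a triple are that short.\<close>

definition lang :: "(nat \<times> 'a list) list set" where
  "lang = {w \<in> lists letters. w \<noteq> [] \<and> (length w \<le> 2 \<or> w \<in> triples \<or> rev w \<in> triples)}"

definition translate :: "'a \<Rightarrow> nat \<times> 'a list \<Rightarrow> nat \<times> 'a list" where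
  "translate g = (\<lambda>(k, u). (k, if k = 0 then u else map ((\<otimes>) g) u))"

lemma translate_simps [simp]:
  "translate g (colour c) = colour c"
  "translate g (point a) = point (g \<otimes> a)"
  by (simp_all add: translate_def)

lemma letters_simps [simp]:
  "colour c \<in> letters \<longleftrightarrow> c \<in> carrier G"
  "point a \<in> letters \<longleftrightarrow> a \<in> carrier G"
  by (auto simp: letters_def)

lemma letter_cases:
  assumes "x \<in> letters"
  obtains c where "x = colour c" "c \<in> carrier G" | a where "x = point a" "a \<in> carrier G"
  using assms by (auto simp: letters_def)

lemma order_closed: "(c, d) \<in> r \<Longrightarrow> c \<in> carrier G \<and> d \<in> carrier G"
  using linear by (auto simp: linear_order_on_def partial_order_on_def preorder_on_def)

lemma order_refl: "c \<in> carrier G \<Longrightarrow> (c, c) \<in> r"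
  using linear
  by (auto simp: linear_order_on_def partial_order_on_def preorder_on_def refl_on_def)

lemma short_in_lang: "set w \<subseteq> letters \<Longrightarrow> w \<noteq> [] \<Longrightarrow> length w \<le> 2 \<Longrightarrow> w \<in> lang"
  by (auto simp: lang_def)

lemma letters_lang: "w \<in> lang \<Longrightarrow> x \<in> set w \<Longrightarrow> x \<in> letters"
  by (auto simp: lang_def)

lemma singleton_lang [simp]: "[x] \<in> lang \<longleftrightarrow> x \<in> letters"
  by (auto simp: lang_def)

lemma length_lang: "w \<in> lang \<Longrightarrow> length w \<le> 3"
proof -
  have "length w \<le> 3" if "rev w \<in> triples"
    using that by (subst length_rev [symmetric]) (auto simp: triples_def simp del: length_rev)
  then show "w \<in> lang \<Longrightarrow> length w \<le> 3"
    by (auto simp: lang_def triples_def)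
qed

sublocale reversible_factorial_language lang
proof
  fix u v :: "(nat \<times> 'a list) list"
  assume uv: "u @ v \<in> lang"
  then have *: "set (u @ v) \<subseteq> letters" "length u + length v \<le> 3"
    using letters_lang[OF uv] length_lang[OF uv] by auto
  show "u \<in> lang" if "u \<noteq> []"
  proof (cases "v = []")
    case False
    then have "length v \<ge> 1" by (cases v) auto
    with * that show ?thesis by (auto intro: short_in_lang)
  qed (use uv in simp)
  show "v \<in> lang" if "v \<noteq> []"
  proof (cases "u = []")
    case False
    then have "length u \<ge> 1" by (cases u) auto
    with * that show ?thesis by (auto intro: short_in_lang)
  qed (use uv in simp)
qed (auto simp: lang_def)

text \<open>A reversed order triple has this shape only when \<open>c = d\<close>, and reflexivity
  covers that case.\<close>

lemma colour_triple_lang: "[colour c, colour d, colour d] \<in> lang \<longleftrightarrow> (c, d) \<in> r"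
  using order_closed order_refl by (auto simp: lang_def triples_def)

lemma point_triple_lang:
  "[point a, point b, colour c] \<in> lang \<longleftrightarrow>
     a \<in> carrier G \<and> b \<in> carrier G \<and> c = inv a \<otimes> b"
  by (auto simp: lang_def triples_def)

text \<open>This separates the two sorts of letters: the cube of a colour is in \<open>lang\<close>
  by reflexivity.\<close>

lemma ppp_notin_lang: "[point a, point a, point a] \<notin> lang"
  by (auto simp: lang_def triples_def)

text \<open>Left translation cancels in the edge colour: \<open>inv (g \<otimes> a) \<otimes> (g
  \<otimes> b) = inv a \<otimes> b\<close>.\<close>

lemma translate_triples: "g \<in> carrier G \<Longrightarrow> w \<in> triples \<Longrightarrow> map (translate g) w \<in> triples"
  by (auto simp: triples_def inv_mult_group m_assoc simp flip: m_assoc[of "inv g" g])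

lemma translate_letters: "g \<in> carrier G \<Longrightarrow> x \<in> letters \<Longrightarrow> translate g x \<in> letters"
  by (auto elim!: letter_cases)

lemma translate_lang: "g \<in> carrier G \<Longrightarrow> w \<in> lang \<Longrightarrow> map (translate g) w \<in> lang"
  using translate_triples[of g w] translate_triples[of g "rev w"]
  by (auto simp: lang_def rev_map translate_letters)

lemma translate_translate:
  assumes "g \<in> carrier G" "h \<in> carrier G" "x \<in> letters"
  shows "translate g (translate h x) = translate (g \<otimes> h) x"
  using assms by (auto simp: m_assoc elim!: letter_cases)

lemma translate_one: "x \<in> letters \<Longrightarrow> translate \<one> x = x"
  by (auto elim!: letter_cases)

lemma involutive_preserving_is_translate:
  assumes f_lang: "\<And>w. w \<in> lang \<Longrightarrow> map f w \<in> lang"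
    and ff: "\<And>x. x \<in> letters \<Longrightarrow> f (f x) = x"
  obtains g where "g \<in> carrier G" "g \<otimes> g = \<one>" "\<And>x. x \<in> letters \<Longrightarrow> f x = translate g x"
proof -
  have f_letters: "f x \<in> letters" if "x \<in> letters" for x
    using f_lang[of "[x]"] that by simp
  have "\<exists>d. f (colour c) = colour d \<and> d \<in> carrier G" if c: "c \<in> carrier G" for c
  proof -
    have "map f [colour c, colour c, colour c] \<in> lang"
      using c by (intro f_lang) (simp only: colour_triple_lang order_refl)
    then have "f (colour c) \<noteq> point a" for a
      using ppp_notin_lang[of a] by auto
    then show ?thesis
      using f_letters[of "colour c"] c by (auto elim!: letter_cases)
  qed
  then obtain t where t: "\<And>c. c \<in> carrier G \<Longrightarrow> f (colour c) = colour (t c) \<and> t c \<in> carrier G"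
    by metis
  have "\<exists>b. f (point a) = point b \<and> b \<in> carrier G" if a: "a \<in> carrier G" for a
  proof -
    have "f (point a) \<in> letters"
      using a f_letters by simp
    then show ?thesis
    proof (cases rule: letter_cases)
      \<comment> \<open>Since \<open>f\<close> sends colours to colours, a point sent to a colour
        could not come back under \<open>f\<close>.\<close>
      case (1 c)
      then show ?thesis
        using ff[of "point a"] a t[of c] by simp
    qed auto
  qed
  then obtain s where s: "\<And>a. a \<in> carrier G \<Longrightarrow> f (point a) = point (s a) \<and> s a \<in> carrier G"
    by metis
  have tt: "t (t c) = c" if "c \<in> carrier G" for c
    using ff[of "colour c"] t that by auto
  have ss: "s (s a) = a" if "a \<in> carrier G" for a
    using ff[of "point a"] s that by auto
  have mono: "(t c, t d) \<in> r" if "(c, d) \<in> r" for c d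
  proof -
    have "[f (colour c), f (colour d), f (colour d)] \<in> lang"
      using f_lang[of "[colour c, colour d, colour d]"] that colour_triple_lang by simp
    then show ?thesis
      using t order_closed[OF that] colour_triple_lang by simp
  qed
  have t_id: "t c = c" if c: "c \<in> carrier G" for c
  proof -
    have anti: "antisym r" and total: "total_on (carrier G) r"
      using linear by (auto simp: linear_order_on_def partial_order_on_def)
    have "(c, t c) \<in> r \<or> (t c, c) \<in> r"
      using total c t order_refl by (metis total_on_def)
    \<comment> \<open>Applying the monotone involution \<open>t\<close> to either comparison yields
      the opposite one.\<close>
    then have "(c, t c) \<in> r \<and> (t c, c) \<in> r"
      using mono tt[OF c] by metis
    then show ?thesis
      using anti by (auto dest: antisymD)
  qed
  have s_mult: "s a = s \<one> \<otimes> a" if a: "a \<in> carrier G" for a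
  proof -
    \<comment> \<open>The edge from \<one> to \<open>a\<close> keeps its colour \<open>a\<close>, so
      \<open>s a\<close> is determined by \<open>s \<one>\<close>.\<close>
    have "[f (point \<one>), f (point a), f (colour (inv \<one> \<otimes> a))] \<in> lang"
      using f_lang[of "[point \<one>, point a, colour (inv \<one> \<otimes> a)]"] a point_triple_lang by simp
    then have "a = inv (s \<one>) \<otimes> s a"
      using a s t t_id point_triple_lang by simp
    then show ?thesis
      using a s by (metis inv_solve_left one_closed)
  qed
  show thesis
  proof
    show "s \<one> \<in> carrier G" "s \<one> \<otimes> s \<one> = \<one>"
      using s ss[of \<one>] s_mult[of "s \<one>"] by auto
    show "f x = translate (s \<one>) x" if "x \<in> letters" for x
      using that
    proof (cases rule: letter_cases)
      case (2 a)
      then show ?thesis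
        using s[of a] s_mult[of a] by simp
    qed (simp add: t t_id)
  qed
qed

section \<open>Its involution group\<close>

text \<open>Only the parity of the exponent matters: the \<int> component decides on reversal, the
  group component translates the points.\<close>

definition act :: "int \<times> 'a \<Rightarrow> (nat \<times> 'a list) list set \<Rightarrow> (nat \<times> 'a list) list set" where
  "act = (\<lambda>(i, g). word_map (odd i) (translate g))"

abbreviation ZG :: "(int \<times> 'a) monoid" where
  "ZG \<equiv> integer_mod_group 2 \<times>\<times> G"

lemma carrier_ZG: "carrier ZG = {0, 1} \<times> carrier G"
  by (auto simp: carrier_integer_mod_group)

lemma group_ZG: "group ZG"
  by (simp add: DirProd_group is_group)

lemma act_act:
  assumes "g \<in> carrier G" "h \<in> carrier G" "A \<in> quot"
  shows "act (i, g) (act (j, h) A) = act ((i + j) mod 2, g \<otimes> h) A"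
proof -
  have "act (i, g) (act (j, h) A) = word_map (odd i \<noteq> odd j) (translate g \<circ> translate h) A"
    using assms by (simp add: act_def word_map_word_map translate_lang)
  also have "word_map (odd i \<noteq> odd j) (translate g \<circ> translate h) =
      word_map (odd i \<noteq> odd j) (translate (g \<otimes> h))"
    using assms by (intro word_map_cong) (simp add: translate_translate letters_lang)
  also have "(odd i \<noteq> odd j) = odd ((i + j) mod 2)"
    by (simp add: even_mod_2_iff)
  finally show ?thesis
    by (simp add: act_def)
qed

lemma act_in_quot: "g \<in> carrier G \<Longrightarrow> A \<in> quot \<Longrightarrow> act (i, g) A \<in> quot"
  by (simp add: act_def word_map_in_quot translate_lang)

lemma act_one: "A \<in> quot \<Longrightarrow> act (0, \<one>) A = A"
  by (erule quot_cases)
    (simp_all add: act_def word_map_singleton translate_one letters_lang map_idI)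

lemma act_extensional: "act p \<in> extensional quot"
  by (auto simp: act_def word_map_def split: prod.split)

lemma act_Bij:
  assumes "g \<in> carrier G" "i \<in> {0, 1}"
  shows "act (i, g) \<in> Bij quot"
proof -
  have "bij_betw (act (i, g)) quot quot"
    using assms by (intro bij_betw_byWitness[where f' = "act (i, inv g)"])
      (auto simp: act_act act_in_quot act_one)
  then show ?thesis
    by (simp add: Bij_def act_extensional)
qed

lemma act_hom: "act \<in> hom ZG (BijGroup quot)"
proof (rule homI)
  show "act p \<in> carrier (BijGroup quot)" if "p \<in> carrier ZG" for p
    using that act_Bij unfolding carrier_ZG by (auto simp: BijGroup_def)
  show "act (p \<otimes>\<^bsub>ZG\<^esub> q) = act p \<otimes>\<^bsub>BijGroup quot\<^esub> act q"
    if "p \<in> carrier ZG" "q \<in> carrier ZG" for p q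
  proof -
    obtain i g j h where [simp]: "p = (i, g)" "q = (j, h)"
      by fastforce
    have in_G: "g \<in> carrier G" "h \<in> carrier G" "i \<in> {0, 1}" "j \<in> {0, 1}"
      using that unfolding carrier_ZG by auto
    have "act ((i + j) mod 2, g \<otimes> h) = compose quot (act (i, g)) (act (j, h))"
      using in_G by (intro extensionalityI[OF act_extensional compose_extensional])
        (simp add: compose_def act_act)
    then show ?thesis
      using in_G act_Bij by (simp add: BijGroup_def)
  qed
qed

text \<open>This one word detects the whole pair: the side on which the colour stands gives the
  parity, and the point gives \<open>g\<close>. Hence \<open>act\<close> is injective.\<close>

lemma act_edge:
  assumes "g \<in> carrier G"
  shows "act (i, g) {[colour \<one>, point \<one>]} =
    {if odd i then [point g, colour \<one>] else [colour \<one>, point g]}"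
  using assms by (simp add: act_def word_map_singleton short_in_lang)

lemma act_inj: "inj_on act (carrier ZG)"
proof (rule inj_onI)
  fix p q
  assume pq: "p \<in> carrier ZG" "q \<in> carrier ZG" and eq: "act p = act q"
  obtain i g j h where [simp]: "p = (i, g)" "q = (j, h)"
    by fastforce
  have in_G: "g \<in> carrier G" "h \<in> carrier G" "i \<in> {0, 1}" "j \<in> {0, 1}"
    using pq unfolding carrier_ZG by auto
  have "act p {[colour \<one>, point \<one>]} = act q {[colour \<one>, point \<one>]}"
    using eq by simp
  then show "p = q"
    using in_G by (auto simp: act_edge split: if_splits)
qed

lemma act_involution:
  assumes g: "g \<in> carrier G" "g \<otimes> g = \<one>"
  shows "act (1, g) \<in> involutions quot conc"
proof -
  have iff: "map (translate g) w \<in> lang \<longleftrightarrow> w \<in> lang" if "w \<in> lists letters" for w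
  proof -
    \<comment> \<open>As \<open>g\<close> squares to \<one>, the translation is its own inverse on
      these words, which turns preservation of \<open>lang\<close> into an equivalence.\<close>
    have "map (translate g) (map (translate g) w) = w"
      using that g by (auto simp: translate_translate translate_one intro!: map_idI)
    then show ?thesis
      using translate_lang[OF g(1)] by metis
  qed
  have anti: "act (1, g) (conc A B) = conc (act (1, g) B) (act (1, g) A)"
    if "A \<in> quot" "B \<in> quot" for A B
  proof -
    have "lists (\<Union> (set ` lang)) \<subseteq> lists letters"
      using letters_lang by (intro lists_mono) blast
    then have "word_map True (translate g) (conc A B) =
        conc (word_map True (translate g) B) (word_map True (translate g) A)"
      using that by (intro word_map_anti iff) auto
    then show ?thesis
      by (simp add: act_def)
  qed
  have "act (1, g) \<noteq> (\<lambda>A\<in>quot. A)"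
  proof
    assume "act (1, g) = (\<lambda>A\<in>quot. A)"
    \<comment> \<open>Reversal puts the point before the colour, so the map is not the identity even
      for \<open>g = \<one>\<close>.\<close>
    then have "act (1, g) {[colour \<one>, point \<one>]} = {[colour \<one>, point \<one>]}"
      by (simp add: short_in_lang)
    then show False
      using g by (simp add: act_edge)
  qed
  then show ?thesis
    using g anti act_extensional
    by (auto simp: involutions_def PiE_def act_in_quot act_act act_one)
qed

section \<open>Determination of the involutions and of the group they generate\<close>

lemma involutions_quot:
  "involutions quot conc = act ` {(1, g) | g. g \<in> carrier G \<and> g \<otimes> g = \<one>}"
proof (intro equalityI subsetI)
  fix \<alpha> assume "\<alpha> \<in> involutions quot conc"
  then obtain f where f: "\<alpha> = word_map True f" "\<And>w. w \<in> lang \<Longrightarrow> map f w \<in> lang"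
    "\<And>x. [x] \<in> lang \<Longrightarrow> f (f x) = x"
    by (rule involution_cases) blast
  obtain g where g: "g \<in> carrier G" "g \<otimes> g = \<one>" "\<And>x. x \<in> letters \<Longrightarrow> f x = translate g x"
    by (rule involutive_preserving_is_translate[of f]) (use f in auto)
  have "\<alpha> = act (1, g)"
    using word_map_cong[of f "translate g" True] g(3) letters_lang by (simp add: f(1) act_def)
  then show "\<alpha> \<in> act ` {(1, g) | g. g \<in> carrier G \<and> g \<otimes> g = \<one>}"
    using g by blast
qed (use act_involution in auto)

text \<open>Plain reversal fixes every letter, so a homomorphism would also fix the product of a
  colour and a point, which reversal moves.\<close>

lemma proper_involution_quot: "proper_involution quot conc (act (1, \<one>))"
proof -
  let ?A = "{[colour \<one>]}" and ?B = "{[point \<one>]}"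
  have "act (1, \<one>) (conc ?A ?B) = {[point \<one>, colour \<one>]}"
    by (simp add: conc_singleton short_in_lang act_edge)
  moreover have "conc (act (1, \<one>) ?A) (act (1, \<one>) ?B) = {[colour \<one>, point \<one>]}"
    by (simp add: conc_singleton short_in_lang act_def word_map_singleton)
  ultimately have "act (1, \<one>) (conc ?A ?B) \<noteq> conc (act (1, \<one>) ?A) (act (1, \<one>) ?B)"
    by simp
  moreover have "?A \<in> quot" "?B \<in> quot"
    by simp_all
  ultimately show ?thesis
    unfolding proper_involution_def using act_involution by (metis one_closed l_one)
qed

text \<open>Multiplying \<open>(1, x)\<close> by \<open>(1, \<one>)\<close> gives
  \<open>(0, x)\<close> for each \<open>x\<close> of order 2; these generate the copy of
  \<open>G\<close>, and \<open>(1, \<one>)\<close> reaches the other coset.\<close>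

lemma generate_ZG:
  assumes gen: "generate G {x \<in> carrier G. ord x = 2} = carrier G"
  shows "generate ZG {(1, g) | g. g \<in> carrier G \<and> g \<otimes> g = \<one>} = carrier ZG"
proof
  let ?K = "{(1, g) | g. g \<in> carrier G \<and> g \<otimes> g = \<one>} :: (int \<times> 'a) set"
  interpret ZG: group ZG by (rule group_ZG)
  have sub: "?K \<subseteq> carrier ZG"
    unfolding carrier_ZG by auto
  show "generate ZG ?K \<subseteq> carrier ZG"
    by (rule ZG.generate_incl[OF sub])
  have mult: "((i + j) mod 2, g \<otimes> h) \<in> generate ZG ?K"
    if "(i, g) \<in> generate ZG ?K" "(j, h) \<in> generate ZG ?K" for i j g h
    using generate.eng[OF that] by simp
  have flip: "(1, \<one>) \<in> generate ZG ?K"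
    by (intro generate.incl) auto
  have involutive: "(0, x) \<in> generate ZG ?K" if "x \<in> carrier G" "ord x = 2" for x
  proof -
    have "x \<otimes> x = \<one>"
      using pow_ord_eq_1[of x] that by (simp add: numeral_2_eq_2)
    then have "(1, x) \<in> generate ZG ?K"
      using that by (intro generate.incl) auto
    from mult[OF this flip] show ?thesis
      using that by simp
  qed
  have even: "x \<in> carrier G \<and> (0, x) \<in> generate ZG ?K"
    if "x \<in> generate G {x \<in> carrier G. ord x = 2}" for x
    using that
  proof induction
    case one
    then show ?case
      using generate.one[of ZG ?K] by simp
  next
    case (incl x)
    then show ?case
      using involutive by simp
  next
    case (inv x)
    then have "inv x \<in> carrier G" "ord (inv x) = 2"
      by simp_all
    then show ?case
      using involutive by simp
  next
    case (eng x y)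
    then show ?case
      using mult[of 0 x 0 y] by simp
  qed
  show "carrier ZG \<subseteq> generate ZG ?K"
  proof
    fix p assume "p \<in> carrier ZG"
    then obtain i g where p: "p = (i, g)" "i \<in> {0, 1}" "g \<in> carrier G"
      unfolding carrier_ZG by auto
    have "(0, g) \<in> generate ZG ?K"
      using even gen p by auto
    then show "p \<in> generate ZG ?K"
      using mult[OF flip, of 0 g] p by auto
  qed
qed

lemma involution_group_iso:
  assumes "generate G {x \<in> carrier G. ord x = 2} = carrier G"
  shows "involution_group quot conc \<cong> ZG"
proof -
  let ?K = "{(1, g) | g. g \<in> carrier G \<and> g \<otimes> g = \<one>} :: (int \<times> 'a) set"
  interpret hom: group_hom ZG "BijGroup quot" act
    using group_ZG group_BijGroup act_hom by (simp add: group_hom_def group_hom_axioms_def)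
  have "?K \<subseteq> carrier ZG"
    unfolding carrier_ZG by auto
  \<comment> \<open>A homomorphism carries the subgroup generated by a set to the subgroup generated
    by its image.\<close>
  then have "generate (BijGroup quot) (act ` ?K) = act ` carrier ZG"
    using hom.generate_img generate_ZG[OF assms] by simp
  then have "carrier (involution_group quot conc) = act ` carrier ZG"
    using involutions_subset_Bij[of quot conc]
    by (simp add: involution_group_def carrier_subgroup_generated involutions_quot Int_absorb1)
  then have "act \<in> iso ZG (involution_group quot conc)"
    using act_inj act_hom
    by (auto simp: iso_def hom_def bij_betw_def involution_group_def)
  then show ?thesis
    using group.iso_sym[OF group_ZG] by (auto simp: is_iso_def)
qed

section \<open>Finiteness and the conclusion\<close>

lemma finite_quot:
  assumes "finite (carrier G)"
  shows "finite quot"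
proof -
  have "lang \<subseteq> {w. set w \<subseteq> letters \<and> length w \<le> 3}"
    using letters_lang length_lang by auto
  moreover have "finite letters"
    using assms by (simp add: letters_def)
  ultimately have "finite lang"
    using finite_lists_length_le finite_subset by blast
  then show ?thesis
    by (simp add: quot_def)
qed

end

lemma finite_imp_finitely_generated_semigroup:
  assumes "semigroup_on S mul" "finite S"
  shows "finitely_generated_semigroup S mul"
proof -
  have "x \<in> S" if "x \<in> subsemigroup_generated mul S" for x
    using that by induction (use assms(1) in \<open>auto simp: semigroup_on_def\<close>)
  then have "subsemigroup_generated mul S = S"
    by (auto intro: subsemigroup_generated.incl)
  then show ?thesis
    using assms(2) by (auto simp: finitely_generated_semigroup_def)
qed

theorem theorem4p7:
  fixes G :: "('a, 'b) monoid_scheme"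
  assumes "group G"
    and "generate G {x \<in> carrier G. group.ord G x = 2} = carrier G"
  shows "(\<exists>(S :: 'a word_class set) mul.
            semigroup_on S mul \<and>
            (\<exists>\<alpha>. proper_involution S mul \<alpha>) \<and>
            involution_group S mul \<cong> integer_mod_group 2 \<times>\<times> G) \<and>
         (finite (carrier G) \<longrightarrow>
          (\<exists>(S :: 'a word_class set) mul.
            semigroup_on S mul \<and>
            finitely_generated_semigroup S mul \<and>
            (\<exists>\<alpha>. proper_involution S mul \<alpha>) \<and>
            involution_group S mul \<cong> integer_mod_group 2 \<times>\<times> G))"
proof -
  \<comment> \<open>The well-ordering theorem supplies the linear order on the colours for a group
    of any cardinality.\<close>
  obtain r where "well_order_on (carrier G) r"
    using well_order_on by blast
  then interpret ordered_group G r
    using assms(1) by (simp add: ordered_group_def ordered_group_axioms_def well_order_on_def)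
  note quot = semigroup_quot proper_involution_quot involution_group_iso[OF assms(2)]
  show ?thesis
    using quot finite_imp_finitely_generated_semigroup[OF semigroup_quot] finite_quot by blast
qed

end
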